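(* Let $n\ge1$ and $d\ge 1$ be integers, $\mu\in\mathbb{R}^d$ with $\mu\neq 0$, and $\sigma>0$. Let $(Y^\ast,A)$ be generated by the Latent Space Model with parameters $(d,\mu,\sigma)$ on $n$ nodes. If $$(4\sigma^2 + 1)^{-1-d/2}\, \Vert\mu\Vert_2^2 \leq \frac{\log 2}{2n} - \frac{\log 2}{n^2},$$ then for every (possibly randomized) estimator $\hat Y$ of $Y^\ast$ based on $A$ (the latent vectors are not observed), i.e. every random $\hat Y\in\{+1,-1\}^n$ such that $Y^\ast\to A\to\hat Y$ is a Markov chain, we have $$\mathbb{P}(\hat Y\neq Y^\ast)\ \geq\ \frac12 .$$
   Context: Latent Space Model with parameters $(d,\mu,\sigma)$: a random undirected graph on nodes $1,\dots,n$ with symmetric adjacency matrix $A$, $A_{ij}\in\{0,1\}$. The true label vector $Y^\ast=(y^\ast_1,\dots,y^\ast_n)$ is uniform on $\{+1,-1\}^n$. Conditionally on $Y^\ast$, latent vectors $z_1,\dots,z_n\in\mathbb{R}^d$ are independent with $z_i\sim N_d(y^\ast_i\mu,\sigma^2 I)$, where $I$ is the $d\times d$ identity matrix. Conditionally on $Y^\ast$ and $z_1,\dots,z_n$, the entries $A_{ij}$, $i<j$, are independent and $A_{ij}$ is Bernoulli with parameter $\exp(-\Vert z_i-z_j\Vert_2^2)$. $\log$ is the natural logarithm. The Markov chain condition means that $\hat Y$ is conditionally independent of $Y^\ast$ given $A$. *)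

theory Defs
  imports "HOL-Probability.Probability"
begin

section \<open>The latent space model\<close>

definition labelings :: "nat \<Rightarrow> (nat \<Rightarrow> real) set" where
  "labelings n = {1..n} \<rightarrow>\<^sub>E {1, -1}"

text \<open>Undirected graphs carry no loops, so the diagonal of an adjacency matrix is zero.\<close>
definition adjacency_matrices :: "nat \<Rightarrow> (nat \<times> nat \<Rightarrow> nat) set" where
  "adjacency_matrices n =
     {a \<in> ({1..n} \<times> {1..n}) \<rightarrow>\<^sub>E {0, 1}.
        \<forall>i\<in>{1..n}. a (i, i) = 0 \<and> (\<forall>j\<in>{1..n}. a (i, j) = a (j, i))}"

definition spherical_gaussian :: "(real ^ 'd) \<Rightarrow> real \<Rightarrow> (real ^ 'd) measure" where
  "spherical_gaussian m \<sigma> =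
     density lborel
       (\<lambda>x. ennreal (exp (- (norm (x - m))\<^sup>2 / (2 * \<sigma>\<^sup>2)) / sqrt ((2 * pi * \<sigma>\<^sup>2) ^ CARD('d))))"

definition latent_law ::
    "nat \<Rightarrow> (real ^ 'd) \<Rightarrow> real \<Rightarrow> (nat \<Rightarrow> real) \<Rightarrow> (nat \<Rightarrow> real ^ 'd) measure" where
  "latent_law n \<mu> \<sigma> y = PiM {1..n} (\<lambda>i. spherical_gaussian (y i *\<^sub>R \<mu>) \<sigma>)"

definition node_pairs :: "nat \<Rightarrow> (nat \<times> nat) set" where
  "node_pairs n = {(i, j). 1 \<le> i \<and> i < j \<and> j \<le> n}"

definition edge_pmf :: "nat \<Rightarrow> (nat \<Rightarrow> real ^ 'd) \<Rightarrow> (nat \<times> nat \<Rightarrow> bool) pmf" where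
  "edge_pmf n z =
     Pi_pmf (node_pairs n) False (\<lambda>(i, j). bernoulli_pmf (exp (- (norm (z i - z j))\<^sup>2)))"

definition adjacency_of :: "nat \<Rightarrow> (nat \<times> nat \<Rightarrow> bool) \<Rightarrow> nat \<times> nat \<Rightarrow> nat" where
  "adjacency_of n e =
     (\<lambda>(i, j) \<in> {1..n} \<times> {1..n}. of_bool (i < j \<and> e (i, j) \<or> j < i \<and> e (j, i)))"

text \<open>The joint law of labels and adjacency matrix, with the latent vectors integrated out.\<close>
definition latent_space_model ::
    "nat \<Rightarrow> (real ^ 'd) \<Rightarrow> real \<Rightarrow> ((nat \<Rightarrow> real) \<times> (nat \<times> nat \<Rightarrow> nat)) measure" where
  "latent_space_model n \<mu> \<sigma> =
     uniform_count_measure (labelings n) \<bind> (\<lambda>y.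
     latent_law n \<mu> \<sigma> y \<bind> (\<lambda>z.
     distr (measure_pmf (edge_pmf n z))
       (count_space (labelings n \<times> adjacency_matrices n))
       (\<lambda>e. (y, adjacency_of n e))))"

text \<open>Conditional independence of \<open>X\<close> and \<open>Z\<close> given \<open>Y\<close>, for discrete random variables. If the
  event \<open>Y = y\<close> is null then \<^const>\<open>cond_prob\<close> is zero, so such \<open>y\<close> impose no condition.\<close>
definition discrete_markov_chain ::
    "'w measure \<Rightarrow> ('w \<Rightarrow> 'x) \<Rightarrow> ('w \<Rightarrow> 'y) \<Rightarrow> ('w \<Rightarrow> 'z) \<Rightarrow> bool" where
  "discrete_markov_chain M X Y Z \<longleftrightarrow>
     (\<forall>x y z. \<P>(\<omega> in M. X \<omega> = x \<and> Z \<omega> = z \<bar> Y \<omega> = y) =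
              \<P>(\<omega> in M. X \<omega> = x \<bar> Y \<omega> = y) * \<P>(\<omega> in M. Z \<omega> = z \<bar> Y \<omega> = y))"

section \<open>The model is a probability measure\<close>

text \<open>Monadic bind is only meaningful for measurable kernels; the following shows that the kernels
  above are Markov kernels between the intended spaces.\<close>

lemma finite_labelings: "finite (labelings n)"
  unfolding labelings_def by (intro finite_PiE) auto

lemma labelings_nonempty: "labelings n \<noteq> {}"
  by (auto simp: labelings_def PiE_eq_empty_iff)

lemma finite_adjacency_matrices: "finite (adjacency_matrices n)"
proof (rule finite_subset)
  show "adjacency_matrices n \<subseteq> ({1..n} \<times> {1..n}) \<rightarrow>\<^sub>E {0, 1}"
    by (auto simp: adjacency_matrices_def)
qed (intro finite_PiE; simp)

lemma adjacency_of_in: "adjacency_of n e \<in> adjacency_matrices n"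
  by (auto simp: adjacency_of_def adjacency_matrices_def)

lemma finite_node_pairs: "finite (node_pairs n)"
  by (rule finite_subset[of _ "{1..n} \<times> {1..n}"]) (auto simp: node_pairs_def)

lemma sets_spherical_gaussian [measurable_cong, simp]: "sets (spherical_gaussian m \<sigma>) = sets borel"
  by (simp add: spherical_gaussian_def)

lemma space_spherical_gaussian [simp]: "space (spherical_gaussian m \<sigma>) = UNIV"
  by (simp add: spherical_gaussian_def)

lemma spherical_gaussian_density_prod:
  fixes x m :: "real ^ 'd"
  shows "exp (- (norm (x - m))\<^sup>2 / (2 * \<sigma>\<^sup>2)) / sqrt ((2 * pi * \<sigma>\<^sup>2) ^ CARD('d)) =
         (\<Prod>b\<in>Basis. normal_density (m \<bullet> b) \<sigma> (x \<bullet> b))"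
proof -
  have "(norm (x - m))\<^sup>2 = (\<Sum>b\<in>Basis. (x \<bullet> b - m \<bullet> b)\<^sup>2)"
    by (subst power2_norm_eq_inner, subst euclidean_inner)
       (simp add: inner_diff_left power2_eq_square)
  then have *: "- (norm (x - m))\<^sup>2 / (2 * \<sigma>\<^sup>2) = (\<Sum>b\<in>Basis. - (x \<bullet> b - m \<bullet> b)\<^sup>2 / (2 * \<sigma>\<^sup>2))"
    by (simp only: sum_negf[symmetric] sum_divide_distrib)
  show ?thesis
    unfolding * normal_density_def prod.distrib exp_sum[OF finite_Basis]
    by (simp only: prod_constant DIM_cart DIM_real mult_1_right real_sqrt_power power_one_over
        times_divide_eq_left mult_1_left)
qed

lemma prob_space_spherical_gaussian:
  fixes m :: "real ^ 'd"
  assumes "\<sigma> > 0"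
  shows "prob_space (spherical_gaussian m \<sigma>)"
proof
  have 1: "(\<integral>\<^sup>+x. ennreal (normal_density a \<sigma> x) \<partial>lborel) = 1" for a
    using prob_space.emeasure_space_1[OF prob_space_normal_density[OF assms, of a]]
    by (simp add: emeasure_density)
  have "emeasure (spherical_gaussian m \<sigma>) (space (spherical_gaussian m \<sigma>)) =
        (\<integral>\<^sup>+x. (\<Prod>b\<in>Basis. ennreal (normal_density (m \<bullet> b) \<sigma> (x \<bullet> b))) \<partial>lborel)"
    unfolding spherical_gaussian_def spherical_gaussian_density_prod
    by (simp add: emeasure_density prod_ennreal)
  also have "\<dots> = 1"
    by (subst nn_integral_lborel_prod) (simp_all add: 1)
  finally show "emeasure (spherical_gaussian m \<sigma>) (space (spherical_gaussian m \<sigma>)) = 1" .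
qed

lemma sets_latent_law [measurable_cong, simp]:
  "sets (latent_law n \<mu> \<sigma> y) = sets (PiM {1..n} (\<lambda>_. borel))"
  unfolding latent_law_def by (intro sets_PiM_cong) auto

lemma prob_space_latent_law: "\<sigma> > 0 \<Longrightarrow> prob_space (latent_law n \<mu> \<sigma> y)"
  unfolding latent_law_def by (intro prob_space_PiM prob_space_spherical_gaussian)

lemma edge_pmf_measurable:
  fixes E :: "(nat \<times> nat \<Rightarrow> bool) set"
  shows "(\<lambda>z::nat \<Rightarrow> real ^ 'd. emeasure (measure_pmf (edge_pmf n z)) E)
           \<in> borel_measurable (PiM {1..n} (\<lambda>_. borel))"
proof -
  define F :: "(nat \<times> nat \<Rightarrow> bool) set" where "F = {f. \<forall>x. x \<notin> node_pairs n \<longrightarrow> f x = False}"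
  have fin: "finite F"
  proof (rule finite_subset)
    show "F \<subseteq> {f. \<forall>x. (x \<in> node_pairs n \<longrightarrow> f x \<in> UNIV) \<and> (x \<notin> node_pairs n \<longrightarrow> f x = False)}"
      by (auto simp: F_def)
    show "finite {f. \<forall>x. (x \<in> node_pairs n \<longrightarrow> f x \<in> (UNIV :: bool set)) \<and>
        (x \<notin> node_pairs n \<longrightarrow> f x = False)}"
      by (intro finite_set_of_finite_funs finite_node_pairs) simp
  qed
  have eq: "emeasure (measure_pmf (edge_pmf n z)) E =
      (\<Sum>f\<in>E \<inter> F. ennreal (\<Prod>(i, j)\<in>node_pairs n.
         let p = exp (- (norm (z i - z j))\<^sup>2) in if f (i, j) then p else 1 - p))" for z :: "nat \<Rightarrow> real ^ 'd"
  proof -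
    have "emeasure (measure_pmf (edge_pmf n z)) E = emeasure (measure_pmf (edge_pmf n z)) (E \<inter> F)"
    proof (rule emeasure_eq_AE)
      show "AE f in measure_pmf (edge_pmf n z). f \<in> E \<longleftrightarrow> f \<in> E \<inter> F"
        unfolding AE_measure_pmf_iff edge_pmf_def
        using set_Pi_pmf_subset[OF finite_node_pairs[of n], of False] unfolding F_def by blast
    qed auto
    also have "\<dots> = (\<Sum>f\<in>E \<inter> F. ennreal (pmf (edge_pmf n z) f))"
      using fin by (subst emeasure_measure_pmf_finite) auto
    also have "\<dots> = (\<Sum>f\<in>E \<inter> F. ennreal (\<Prod>(i, j)\<in>node_pairs n.
         let p = exp (- (norm (z i - z j))\<^sup>2) in if f (i, j) then p else 1 - p))"
      by (intro sum.cong refl arg_cong[of _ _ ennreal])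
         (auto simp: edge_pmf_def pmf_Pi[OF finite_node_pairs] F_def Let_def intro!: prod.cong)
    finally show ?thesis .
  qed
  show ?thesis
    unfolding eq Let_def
  proof (intro borel_measurable_sum measurable_compose[OF _ measurable_ennreal] borel_measurable_prod)
    fix f :: "nat \<times> nat \<Rightarrow> bool" and ij assume ij: "ij \<in> node_pairs n"
    obtain i j where [simp]: "ij = (i, j)" by (cases ij)
    have [measurable]: "(\<lambda>z::nat \<Rightarrow> real ^ 'd. z i) \<in> borel_measurable (PiM {1..n} (\<lambda>_. borel))"
      "(\<lambda>z::nat \<Rightarrow> real ^ 'd. z j) \<in> borel_measurable (PiM {1..n} (\<lambda>_. borel))"
      using ij by (auto simp: node_pairs_def intro!: measurable_component_singleton)
    show "(\<lambda>z::nat \<Rightarrow> real ^ 'd. case ij of (i, j) \<Rightarrow>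
        if f (i, j) then exp (- (norm (z i - z j))\<^sup>2) else 1 - exp (- (norm (z i - z j))\<^sup>2))
        \<in> borel_measurable (PiM {1..n} (\<lambda>_. borel))"
      unfolding \<open>ij = (i, j)\<close> prod.case by (cases "f (i, j)") (simp_all only: if_True if_False, measurable)
  qed
qed

lemma graph_kernel_measurable:
  assumes "y \<in> labelings n"
  shows "(\<lambda>z::nat \<Rightarrow> real ^ 'd. distr (measure_pmf (edge_pmf n z))
           (count_space (labelings n \<times> adjacency_matrices n)) (\<lambda>e. (y, adjacency_of n e)))
         \<in> PiM {1..n} (\<lambda>_. borel) \<rightarrow>\<^sub>M prob_algebra (count_space (labelings n \<times> adjacency_matrices n))"
proof (rule measurable_prob_algebraI)
  have m: "(\<lambda>e. (y, adjacency_of n e)) \<in>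
      measurable (measure_pmf (edge_pmf n z)) (count_space (labelings n \<times> adjacency_matrices n))"
    for z :: "nat \<Rightarrow> real ^ 'd"
    using assms adjacency_of_in by auto
  show p: "prob_space (distr (measure_pmf (edge_pmf n z))
      (count_space (labelings n \<times> adjacency_matrices n)) (\<lambda>e. (y, adjacency_of n e)))"
    for z :: "nat \<Rightarrow> real ^ 'd"
    by (intro prob_space.prob_space_distr m measure_pmf.prob_space_axioms)
  show "(\<lambda>z::nat \<Rightarrow> real ^ 'd. distr (measure_pmf (edge_pmf n z))
           (count_space (labelings n \<times> adjacency_matrices n)) (\<lambda>e. (y, adjacency_of n e)))
         \<in> PiM {1..n} (\<lambda>_. borel) \<rightarrow>\<^sub>M subprob_algebra (count_space (labelings n \<times> adjacency_matrices n))"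
    by (rule measurable_subprob_algebra)
       (auto intro!: prob_space_imp_subprob_space p edge_pmf_measurable simp: emeasure_distr[OF m]
         simp del: One_nat_def)
qed

lemma label_kernel_measurable:
  fixes \<mu> :: "real ^ 'd"
  assumes "\<sigma> > 0"
  shows "(\<lambda>y. latent_law n \<mu> \<sigma> y \<bind> (\<lambda>z. distr (measure_pmf (edge_pmf n z))
           (count_space (labelings n \<times> adjacency_matrices n)) (\<lambda>e. (y, adjacency_of n e))))
         \<in> uniform_count_measure (labelings n) \<rightarrow>\<^sub>M
           prob_algebra (count_space (labelings n \<times> adjacency_matrices n))"
proof -
  have "latent_law n \<mu> \<sigma> y \<in> space (prob_algebra (PiM {1..n} (\<lambda>_. borel)))" for y
    using prob_space_latent_law[OF assms] by (simp add: space_prob_algebra)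
  then show ?thesis
    by (auto simp: measurable_cong_sets[OF sets_uniform_count_measure_count_space refl]
        space_prob_algebra[of "count_space _"]
        intro!: prob_space_bind' sets_bind' graph_kernel_measurable
        simp del: sets_count_space One_nat_def)
qed

lemma uniform_labels:
  "uniform_count_measure (labelings n) \<in> space (prob_algebra (uniform_count_measure (labelings n)))"
  using prob_space_uniform_count_measure[OF finite_labelings labelings_nonempty]
  by (simp add: space_prob_algebra)

lemma prob_space_latent_space_model: "\<sigma> > 0 \<Longrightarrow> prob_space (latent_space_model n \<mu> \<sigma>)"
  unfolding latent_space_model_def
  by (intro prob_space_bind'[OF uniform_labels label_kernel_measurable])

lemma sets_latent_space_model:
  "\<sigma> > 0 \<Longrightarrow> sets (latent_space_model n \<mu> \<sigma>) = Pow (labelings n \<times> adjacency_matrices n)"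
  unfolding latent_space_model_def
  by (simp add: sets_bind'[OF uniform_labels label_kernel_measurable])

end

(* The distances between the latent vectors do not change when all of them are negated, and
   negating them turns the model conditioned on the labels y into the model conditioned on -y.
   Hence the label vectors y and -y are equally likely given the graph, and no function of the
   graph can tell them apart: a guess is correct with probability at most 1/2. *)
theory Submission
  imports Defs
begin

text \<open>Scaling by -1 multiplies volume by |-1| to the power of the dimension, which is
  1.\<close>

lemma lborel_distr_uminus_euclidean:
  "distr lborel borel uminus = (lborel :: 'a::euclidean_space measure)"
  by (subst lborel_affine[of "-1" "0::'a"]) (auto simp: density_1 one_ennreal_def[symmetric])

text \<open>The density sees \<open>x\<close> only through its distance to the mean, and
  \<open>-x\<close> is as far from \<open>m\<close> as \<open>x\<close> is from
  \<open>-m\<close>.\<close>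

lemma distr_uminus_spherical_gaussian:
  fixes m :: "real ^ 'd"
  shows "distr (spherical_gaussian m \<sigma>) borel uminus = spherical_gaussian (- m) \<sigma>"
proof -
  have "norm (- x - m) = norm (x + m)" for x :: "real ^ 'd"
    using norm_minus_cancel[of "x + m"] by (simp add: minus_add_distrib del: norm_minus_cancel)
  then show ?thesis
    unfolding spherical_gaussian_def
    \<comment> \<open>Writing the Lebesgue measure on the right as its own reflection lets
      \<open>density_distr\<close> pull the reflection out of the density.\<close>
    by (subst (2) lborel_distr_uminus_euclidean[symmetric], subst density_distr)
       (simp_all add: norm_minus_commute[of m])
qed

text \<open>\<open>compose\<close> keeps the result undefined outside \<open>{1..n}\<close>, as
  membership in the extensional set \<open>labelings n\<close> requires.\<close>

definition negate_labels :: "nat \<Rightarrow> (nat \<Rightarrow> real) \<Rightarrow> nat \<Rightarrow> real" where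
  "negate_labels n = compose {1..n} uminus"

lemma negate_labels_in: "y \<in> labelings n \<Longrightarrow> negate_labels n y \<in> labelings n"
  by (auto simp: negate_labels_def labelings_def compose_def PiE_iff)

lemma negate_labels_twice: "y \<in> labelings n \<Longrightarrow> negate_labels n (negate_labels n y) = y"
  by (auto simp: negate_labels_def labelings_def compose_def PiE_iff extensional_def fun_eq_iff)

lemma bij_betw_negate_labels: "bij_betw (negate_labels n) (labelings n) (labelings n)"
  by (rule bij_betwI[of _ _ _ "negate_labels n"]) (auto simp: negate_labels_in negate_labels_twice)

text \<open>Node 1 exists because \<open>n \<ge> 1\<close>, and its label is nonzero. The empty
  labeling for \<open>n = 0\<close> would be a fixed point.\<close>

lemma negate_labels_neq:
  assumes "y \<in> labelings n" "n \<ge> 1"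
  shows "negate_labels n y \<noteq> y"
proof
  assume "negate_labels n y = y"
  then have "- y 1 = y 1"
    using assms(2) by (auto simp: negate_labels_def compose_def fun_eq_iff split: if_splits)
  moreover have "y 1 \<in> {1, -1}"
    using assms by (auto simp: labelings_def)
  ultimately show False by auto
qed

text \<open>Negation acts on each coordinate separately, so the image of the product measure is the
  product of the reflected Gaussians, whose means are negated.\<close>

lemma latent_law_negate_labels:
  assumes "\<sigma> > 0"
  shows "latent_law n \<mu> \<sigma> (negate_labels n y) =
         distr (latent_law n \<mu> \<sigma> y) (PiM {1..n} (\<lambda>_. borel)) (compose {1..n} uminus)"
proof -
  have "distr (latent_law n \<mu> \<sigma> y)
          (PiM {1..n} (\<lambda>i. spherical_gaussian (y i *\<^sub>R \<mu>) \<sigma>)) (compose {1..n} uminus) =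
        PiM {1..n} (\<lambda>i. distr (spherical_gaussian (y i *\<^sub>R \<mu>) \<sigma>)
          (spherical_gaussian (y i *\<^sub>R \<mu>) \<sigma>) uminus)"
    unfolding latent_law_def
    by (rule distr_PiM_finite_prob_space') (auto simp: prob_space_spherical_gaussian[OF assms])
  also have "\<dots> = PiM {1..n} (\<lambda>i. spherical_gaussian (negate_labels n y i *\<^sub>R \<mu>) \<sigma>)"
  proof (rule PiM_cong)
    fix i assume i: "i \<in> {1..n}"
    have "distr (spherical_gaussian (y i *\<^sub>R \<mu>) \<sigma>) (spherical_gaussian (y i *\<^sub>R \<mu>) \<sigma>) uminus =
          distr (spherical_gaussian (y i *\<^sub>R \<mu>) \<sigma>) borel uminus"
      by (rule distr_cong) auto
    then show "distr (spherical_gaussian (y i *\<^sub>R \<mu>) \<sigma>) (spherical_gaussian (y i *\<^sub>R \<mu>) \<sigma>) uminus =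
          spherical_gaussian (negate_labels n y i *\<^sub>R \<mu>) \<sigma>"
      using i by (simp add: distr_uminus_spherical_gaussian negate_labels_def compose_def)
  qed simp
  \<comment> \<open>Only the sigma-algebra of the target matters; the product of Gaussians is
    exchanged for the product of \<open>borel\<close>, the domain of the edge kernel.\<close>
  also have "distr (latent_law n \<mu> \<sigma> y)
          (PiM {1..n} (\<lambda>i. spherical_gaussian (y i *\<^sub>R \<mu>) \<sigma>)) (compose {1..n} uminus) =
        distr (latent_law n \<mu> \<sigma> y) (PiM {1..n} (\<lambda>_. borel)) (compose {1..n} uminus)"
    by (rule distr_cong[OF refl _ refl]) (intro sets_PiM_cong refl sets_spherical_gaussian)
  finally show ?thesis
    by (simp only: latent_law_def)
qed

text \<open>Edge probabilities depend only on distances, which a common sign flip preserves; all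
  node pairs lie in \<open>{1..n}\<close>, where \<open>compose\<close> really negates.\<close>

lemma edge_pmf_compose_uminus: "edge_pmf n (compose {1..n} uminus z) = edge_pmf n z"
proof -
  have "norm (- z i - (- z j)) = norm (z i - z j)" for i j
    by (simp only: minus_diff_minus norm_minus_cancel)
  then show ?thesis
    unfolding edge_pmf_def
    by (intro Pi_pmf_cong) (auto simp: node_pairs_def compose_def)
qed

text \<open>Measurability of both kernels turns the two binds into iterated integrals. The condition
  on the label stays inside the edge event, which is empty for every other label vector.\<close>

lemma emeasure_latent_space_model:
  fixes \<mu> :: "real ^ 'd"
  assumes "\<sigma> > 0" "y\<^sub>0 \<in> labelings n" "a \<in> adjacency_matrices n"
  shows "emeasure (latent_space_model n \<mu> \<sigma>) {(y\<^sub>0, a)} =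
    (\<integral>\<^sup>+y. (\<integral>\<^sup>+z. emeasure (edge_pmf n z) {e. y = y\<^sub>0 \<and> adjacency_of n e = a} \<partial>latent_law n \<mu> \<sigma> y)
      \<partial>uniform_count_measure (labelings n))"
proof -
  let ?N = "count_space (labelings n \<times> adjacency_matrices n)"
  have X: "{(y\<^sub>0, a)} \<in> sets ?N"
    using assms by auto
  have law: "latent_law n \<mu> \<sigma> y \<in> space (prob_algebra (PiM {1..n} (\<lambda>_. borel)))" for y
    using prob_space_latent_law[OF assms(1)] by (simp add: space_prob_algebra)
  have kernel: "emeasure (distr (edge_pmf n z) ?N (\<lambda>e. (y, adjacency_of n e))) {(y\<^sub>0, a)} =
      emeasure (edge_pmf n z) {e. y = y\<^sub>0 \<and> adjacency_of n e = a}"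
    if "y \<in> labelings n" for y and z :: "nat \<Rightarrow> real ^ 'd"
    using that X adjacency_of_in
    by (subst emeasure_distr) (auto intro!: arg_cong2[where f = emeasure])
  have latent: "emeasure (latent_law n \<mu> \<sigma> y \<bind> (\<lambda>z.
        distr (edge_pmf n z) ?N (\<lambda>e. (y, adjacency_of n e)))) {(y\<^sub>0, a)} =
      (\<integral>\<^sup>+z. emeasure (edge_pmf n z) {e. y = y\<^sub>0 \<and> adjacency_of n e = a} \<partial>latent_law n \<mu> \<sigma> y)"
    if "y \<in> labelings n" for y
    by (simp only: emeasure_bind_prob_algebra[OF law graph_kernel_measurable[OF that] X] kernel[OF that])
  show ?thesis
    unfolding latent_space_model_def
      emeasure_bind_prob_algebra[OF uniform_labels label_kernel_measurable[OF assms(1)] X]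
    by (rule nn_integral_cong) (simp only: latent space_uniform_count_measure)
qed

lemma nn_integral_uniform_count_measure_bij:
  assumes "finite S" "bij_betw f S S"
  shows "(\<integral>\<^sup>+x. g (f x) \<partial>uniform_count_measure S) = (\<integral>\<^sup>+x. g x \<partial>uniform_count_measure S)"
  unfolding uniform_count_measure_def nn_integral_point_measure_finite[OF assms(1)]
  by (rule sum.reindex_bij_betw[OF assms(2)])

text \<open>Substitute the negated labels in the outer integral, which permutes the uniform label
  vectors, and the negated latent vectors in the inner one, which leaves the edge law alone.\<close>

lemma emeasure_latent_space_model_negate_labels:
  fixes \<mu> :: "real ^ 'd"
  assumes "\<sigma> > 0" "y\<^sub>0 \<in> labelings n" "a \<in> adjacency_matrices n"
  shows "emeasure (latent_space_model n \<mu> \<sigma>) {(negate_labels n y\<^sub>0, a)} =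
         emeasure (latent_space_model n \<mu> \<sigma>) {(y\<^sub>0, a)}"
proof -
  let ?U = "uniform_count_measure (labelings n)"
  let ?E = "\<lambda>y y\<^sub>0. {e. y = y\<^sub>0 \<and> adjacency_of n e = a}"
  let ?g = "\<lambda>y\<^sub>0 y. \<integral>\<^sup>+z. emeasure (edge_pmf n z) (?E y y\<^sub>0) \<partial>latent_law n \<mu> \<sigma> y"
  have compose_meas: "compose {1..n} uminus \<in> latent_law n \<mu> \<sigma> y \<rightarrow>\<^sub>M PiM {1..n} (\<lambda>_. borel)" for y
    unfolding compose_def by measurable
  have "?g (negate_labels n y\<^sub>0) (negate_labels n y) = ?g y\<^sub>0 y" if "y \<in> labelings n" for y
  proof -
    have eq: "negate_labels n y = negate_labels n y\<^sub>0 \<longleftrightarrow> y = y\<^sub>0"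
      using negate_labels_twice assms(2) that by metis
    show ?thesis
      unfolding latent_law_negate_labels[OF assms(1)] eq
      by (subst nn_integral_distr[OF compose_meas])
         (simp_all only: edge_pmf_measurable measurable_distr_eq1 edge_pmf_compose_uminus)
  qed
  then have "(\<integral>\<^sup>+y. ?g (negate_labels n y\<^sub>0) (negate_labels n y) \<partial>?U) = (\<integral>\<^sup>+y. ?g y\<^sub>0 y \<partial>?U)"
    by (intro nn_integral_cong) (simp only: space_uniform_count_measure)
  moreover have "(\<integral>\<^sup>+y. ?g (negate_labels n y\<^sub>0) (negate_labels n y) \<partial>?U) =
      (\<integral>\<^sup>+y. ?g (negate_labels n y\<^sub>0) y \<partial>?U)"
    by (rule nn_integral_uniform_count_measure_bij[OF finite_labelings bij_betw_negate_labels])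
  ultimately show ?thesis
    by (simp only: emeasure_latent_space_model negate_labels_in assms)
qed

text \<open>Given \<open>A = a\<close>, the values \<open>x\<close> and \<open>f x\<close> are
  distinct and equally likely, so each has conditional probability at most 1/2. By conditional
  independence, a guess \<open>x\<close> is then right at most half of the time.\<close>

lemma (in prob_space) prob_wrong_guess_ge_half:
  assumes S: "finite S" and T: "finite T"
    and X: "X \<in> M \<rightarrow>\<^sub>M count_space S" and A: "A \<in> M \<rightarrow>\<^sub>M count_space T"
    and G: "G \<in> M \<rightarrow>\<^sub>M count_space S"
    and markov: "discrete_markov_chain M X A G"
    and f: "\<And>x. x \<in> S \<Longrightarrow> f x \<in> S" "\<And>x. x \<in> S \<Longrightarrow> f x \<noteq> x"
    and sym: "\<And>x a. x \<in> S \<Longrightarrow> a \<in> T \<Longrightarrow>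
      \<P>(\<omega> in M. X \<omega> = f x \<and> A \<omega> = a) = \<P>(\<omega> in M. X \<omega> = x \<and> A \<omega> = a)"
  shows "\<P>(\<omega> in M. G \<omega> \<noteq> X \<omega>) \<ge> 1 / 2"
proof -
  have XS: "X \<omega> \<in> S" and AT: "A \<omega> \<in> T" and GS: "G \<omega> \<in> S" if "\<omega> \<in> space M" for \<omega>
    using that X A G by (auto dest: measurable_space)
  \<comment> \<open>Intersecting \<open>{x}\<close> with \<open>S\<close> makes this hold for every
    \<open>x\<close>, including values outside \<open>S\<close>; likewise for \<open>A\<close> and
    \<open>G\<close> below.\<close>
  have Xev: "{\<omega> \<in> space M. X \<omega> = x} \<in> events" for x
    proof -
    have "{\<omega> \<in> space M. X \<omega> = x} = X -` ({x} \<inter> S) \<inter> space M"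
      using XS by auto
    then show ?thesis
      using measurable_sets[OF X, of "{x} \<inter> S"] by simp
  qed
  have Aev: "{\<omega> \<in> space M. A \<omega> = a} \<in> events" for a
    proof -
    have "{\<omega> \<in> space M. A \<omega> = a} = A -` ({a} \<inter> T) \<inter> space M"
      using AT by auto
    then show ?thesis
      using measurable_sets[OF A, of "{a} \<inter> T"] by simp
  qed
  have Gev: "{\<omega> \<in> space M. G \<omega> = x} \<in> events" for x
    proof -
    have "{\<omega> \<in> space M. G \<omega> = x} = G -` ({x} \<inter> S) \<inter> space M"
      using GS by auto
    then show ?thesis
      using measurable_sets[OF G, of "{x} \<inter> S"] by simp
  qed
  note ev = sets.sets_Collect_conj Xev Aev Gev
  define P where "P x a = \<P>(\<omega> in M. X \<omega> = x \<and> A \<omega> = a)" for x a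
  define Q where "Q x a = \<P>(\<omega> in M. G \<omega> = x \<and> A \<omega> = a)" for x a
  \<comment> \<open>Correct guess \<open>x\<close> on observation \<open>a\<close>, bracketed as in
    the numerator of \<open>cond_prob\<close>.\<close>
  define H where "H x a = {\<omega> \<in> space M. (X \<omega> = x \<and> G \<omega> = x) \<and> A \<omega> = a}" for x a
  have Hev: "H x a \<in> events" for x a
    unfolding H_def by (intro ev)
  have half: "2 * P x a \<le> prob {\<omega> \<in> space M. A \<omega> = a}" if "x \<in> S" "a \<in> T" for x a
  proof -
    have "2 * P x a = P x a + P (f x) a"
      using sym[OF that] by (simp add: P_def)
    also have "\<dots> = prob ({\<omega> \<in> space M. X \<omega> = x \<and> A \<omega> = a} \<union> {\<omega> \<in> space M. X \<omega> = f x \<and> A \<omega> = a})"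
      unfolding P_def using f(2)[OF that(1)]
      by (intro finite_measure_Union[symmetric]) (auto intro: ev)
    also have "\<dots> \<le> prob {\<omega> \<in> space M. A \<omega> = a}"
      by (intro finite_measure_mono) (auto intro: ev)
    finally show ?thesis .
  qed
  have bound: "prob (H x a) \<le> Q x a / 2" if "x \<in> S" "a \<in> T" for x a
  \<comment> \<open>On a null observation the Markov condition says nothing, but there
    \<open>H x a\<close> is null as well.\<close>
  proof (cases "prob {\<omega> \<in> space M. A \<omega> = a} = 0")
    case True
    have "prob (H x a) \<le> prob {\<omega> \<in> space M. A \<omega> = a}"
      by (intro finite_measure_mono) (auto intro: ev simp: H_def)
    then show ?thesis
      using True measure_nonneg[of M "{\<omega> \<in> space M. G \<omega> = x \<and> A \<omega> = a}"]
      unfolding Q_def by linarith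
  next
    case False
    define s where "s = prob {\<omega> \<in> space M. A \<omega> = a}"
    have s: "s > 0" using False by (simp add: s_def zero_less_measure_iff)
    \<comment> \<open>The Markov condition with the same value \<open>x\<close> for label and
      guess.\<close>
    have "prob (H x a) / s = P x a / s * (Q x a / s)"
      using markov unfolding discrete_markov_chain_def cond_prob_def
      by (auto simp: H_def P_def Q_def s_def)
    then have "prob (H x a) = P x a / s * Q x a"
      using s by (simp add: field_simps)
    also have "\<dots> \<le> 1 / 2 * Q x a"
      using half[OF that] s by (intro mult_right_mono) (auto simp: Q_def s_def field_simps)
    finally show ?thesis by simp
  qed
  \<comment> \<open>The events \<open>H x a\<close> partition the correct guesses, and the events
    measured by \<open>Q\<close> are disjoint, so the bounds add up to at most 1/2.\<close>
  have "prob {\<omega> \<in> space M. G \<omega> = X \<omega>} = prob (\<Union>(x, a)\<in>S \<times> T. H x a)"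
    using XS AT by (intro arg_cong[where f = prob]) (auto simp: H_def)
  also have "\<dots> = (\<Sum>(x, a)\<in>S \<times> T. prob (H x a))"
    using S T by (subst finite_measure_finite_Union)
      (auto simp: Hev split_beta, auto simp: H_def disjoint_family_on_def)
  also have "\<dots> \<le> (\<Sum>(x, a)\<in>S \<times> T. Q x a / 2)"
    by (intro sum_mono) (use bound in auto)
  also have "\<dots> = (\<Sum>(x, a)\<in>S \<times> T. Q x a) / 2"
    by (simp add: sum_divide_distrib split_beta)
  also have "(\<Sum>(x, a)\<in>S \<times> T. Q x a) = prob (\<Union>(x, a)\<in>S \<times> T. {\<omega> \<in> space M. G \<omega> = x \<and> A \<omega> = a})"
    using S T unfolding Q_def by (subst finite_measure_finite_Union)
      (auto simp: disjoint_family_on_def split_beta intro: ev)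
  also have "\<dots> \<le> 1"
    by (rule prob_le_1)
  finally have correct: "prob {\<omega> \<in> space M. G \<omega> = X \<omega>} \<le> 1 / 2"
    by simp
  have "{\<omega> \<in> space M. G \<omega> = X \<omega>} = (\<Union>x\<in>S. {\<omega> \<in> space M. X \<omega> = x \<and> G \<omega> = x})"
    using XS by auto
  also have "\<dots> \<in> events"
    using S by (intro sets.finite_UN) (auto intro: ev)
  finally have "prob {\<omega> \<in> space M. G \<omega> \<noteq> X \<omega>} = 1 - prob {\<omega> \<in> space M. G \<omega> = X \<omega>}"
    by (rule prob_neg)
  with correct show ?thesis by simp
qed

theorem theorem2:
  fixes n :: nat
    and \<mu> :: "real ^ 'd"
    and \<sigma> :: real
    and M :: "'w measure"
    and Y Yhat :: "'w \<Rightarrow> nat \<Rightarrow> real"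
    and A :: "'w \<Rightarrow> nat \<times> nat \<Rightarrow> nat"
  assumes "n \<ge> 1" and "\<mu> \<noteq> 0" and "\<sigma> > 0"
    and "prob_space M"
    and "Y \<in> M \<rightarrow>\<^sub>M count_space (labelings n)"
    and "A \<in> M \<rightarrow>\<^sub>M count_space (adjacency_matrices n)"
    and "distr M (count_space (labelings n \<times> adjacency_matrices n)) (\<lambda>\<omega>. (Y \<omega>, A \<omega>)) =
         latent_space_model n \<mu> \<sigma>"
    and "(4 * \<sigma>\<^sup>2 + 1) powr (- 1 - real CARD('d) / 2) * (norm \<mu>)\<^sup>2
         \<le> ln 2 / (2 * real n) - ln 2 / (real n)\<^sup>2"
    and "Yhat \<in> M \<rightarrow>\<^sub>M count_space (labelings n)"
    and "discrete_markov_chain M Y A Yhat"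
  shows "\<P>(\<omega> in M. Yhat \<omega> \<noteq> Y \<omega>) \<ge> 1 / 2"
proof -
  interpret prob_space M by fact
  let ?N = "count_space (labelings n \<times> adjacency_matrices n)"
  have Y: "Y \<omega> \<in> labelings n" and A: "A \<omega> \<in> adjacency_matrices n" if "\<omega> \<in> space M" for \<omega>
    using that assms(5,6) by (auto dest: measurable_space)
  \<comment> \<open>For finite sets the product of the counting spaces is the counting space on the
    product, where the model lives.\<close>
  have "(\<lambda>\<omega>. (Y \<omega>, A \<omega>)) \<in> M \<rightarrow>\<^sub>M count_space (labelings n) \<Otimes>\<^sub>M count_space (adjacency_matrices n)"
    using assms(5,6) by measurable
  then have YA: "(\<lambda>\<omega>. (Y \<omega>, A \<omega>)) \<in> M \<rightarrow>\<^sub>M ?N"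
    by (simp add: pair_measure_countable countable_finite finite_labelings finite_adjacency_matrices)
  \<comment> \<open>Carries the symmetry of the model's point masses over to events of
    \<open>M\<close>.\<close>
  have joint: "prob {\<omega> \<in> space M. Y \<omega> = y \<and> A \<omega> = a} =
      measure (latent_space_model n \<mu> \<sigma>) {(y, a)}"
    if "y \<in> labelings n" "a \<in> adjacency_matrices n" for y a
    unfolding assms(7)[symmetric] using that
    by (subst measure_distr[OF YA]) (auto intro!: arg_cong[where f = prob])
  show ?thesis
  proof (rule prob_wrong_guess_ge_half[OF finite_labelings finite_adjacency_matrices
        assms(5,6,9,10), where f = "negate_labels n"])
    fix y a assume "y \<in> labelings n" "a \<in> adjacency_matrices n"
    then show "prob {\<omega> \<in> space M. Y \<omega> = negate_labels n y \<and> A \<omega> = a} =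
        prob {\<omega> \<in> space M. Y \<omega> = y \<and> A \<omega> = a}"
      using emeasure_latent_space_model_negate_labels[OF \<open>\<sigma> > 0\<close>, of y n a \<mu>]
      by (simp only: joint negate_labels_in) (simp add: measure_def)
  qed (use negate_labels_in negate_labels_neq \<open>n \<ge> 1\<close> in auto)
qed

end
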